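(* Let $\nu$ be a locally finite Borel measure on $\mathbb{R}$ (with the Euclidean metric). Then the conformal dimension of $\nu$ is zero: $\dim_{\mathrm{C}} \nu = 0$.
   Context: For a Borel measure $\nu$ on a metric space $X$, the (upper) Hausdorff dimension of $\nu$ is $$\dim_{\mathrm{H}} \nu := \inf\{\dim_{\mathrm{H}} A : A \subset X \text{ Borel},\ \nu(X \setminus A) = 0\},$$ where $\dim_{\mathrm{H}} A$ is the Hausdorff dimension of the set $A$. A homeomorphism $f \colon (X,d) \to (Y,d')$ between metric spaces is quasisymmetric if there is a homeomorphism $\eta \colon [0,\infty) \to [0,\infty)$ such that for all $x,y,z \in X$ and $t \geq 0$, $d(x,y) \leq t\, d(x,z)$ implies $d'(f(x),f(y)) \leq \eta(t)\, d'(f(x),f(z))$. Let $(X,\mu,d)$ be a metric measure space, and let $\operatorname{spt}\mu$ denote the support of $\mu$. The conformal dimension of $\mu$ is $$\dim_{\mathrm{C}} \mu := \inf_{f} \dim_{\mathrm{H}} f_{\sharp}\mu,$$ where the infimum is taken over all quasisymmetric homeomorphisms $f$ between $(\operatorname{spt}\mu, d)$ and any metric space $(Y,d')$, and $f_{\sharp}\mu$ is the push-forward measure on $Y$, $f_{\sharp}\mu(B) = \mu(f^{-1}(B))$. *)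

theory Defs
  imports "HOL-Analysis.Analysis"
begin

definition borel_of :: "'a topology \<Rightarrow> 'a measure" where
  "borel_of X = sigma (topspace X) {U. openin X U}"

definition mdiam :: "'a metric \<Rightarrow> 'a set \<Rightarrow> ennreal" where
  "mdiam m U = (SUP x\<in>U. SUP y\<in>U. ennreal (mdist m x y))"

text \<open>The power \<open>(diam U)\<^sup>s\<close> for \<open>U\<close> of finite diameter, with the conventions that make the
  zero-dimensional Hausdorff measure the counting measure: the empty set contributes \<open>0\<close>, and
  \<open>(diam U)\<^sup>0 = 1\<close> for nonempty \<open>U\<close>, whereas \<open>0 powr 0 = 0\<close>.\<close>

definition diam_power :: "'a metric \<Rightarrow> real \<Rightarrow> 'a set \<Rightarrow> ennreal" where
  "diam_power m s U =
     (if U = {} then 0 else if s = 0 then 1 else ennreal (enn2real (mdiam m U) powr s))"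

definition hausdorff_premeasure :: "'a metric \<Rightarrow> real \<Rightarrow> real \<Rightarrow> 'a set \<Rightarrow> ennreal" where
  "hausdorff_premeasure m s \<delta> A =
     (INF U \<in> {U :: nat \<Rightarrow> 'a set. (\<forall>i. U i \<subseteq> mspace m \<and> mdiam m (U i) \<le> ennreal \<delta>) \<and> A \<subseteq> (\<Union>i. U i)}.
        \<Sum>i. diam_power m s (U i))"

definition hausdorff_measure :: "'a metric \<Rightarrow> real \<Rightarrow> 'a set \<Rightarrow> ennreal" where
  "hausdorff_measure m s A = (SUP \<delta> \<in> {0<..}. hausdorff_premeasure m s \<delta> A)"

text \<open>The infimum of the empty set is \<open>\<infinity>\<close>, and the empty set has dimension \<open>0\<close>.\<close>

definition hausdorff_dim :: "'a metric \<Rightarrow> 'a set \<Rightarrow> ennreal" where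
  "hausdorff_dim m A = (INF s \<in> {s. 0 \<le> s \<and> hausdorff_measure m s A = 0}. ennreal s)"

definition hausdorff_dim_measure :: "'a metric \<Rightarrow> 'a measure \<Rightarrow> ennreal" where
  "hausdorff_dim_measure m \<nu> =
     (INF A \<in> {A \<in> sets (borel_of (mtopology_of m)). emeasure \<nu> (mspace m - A) = 0}.
        hausdorff_dim m A)"

definition quasisymmetric :: "'a metric \<Rightarrow> 'b metric \<Rightarrow> ('a \<Rightarrow> 'b) \<Rightarrow> bool" where
  "quasisymmetric m m' f \<longleftrightarrow>
     homeomorphic_map (mtopology_of m) (mtopology_of m') f \<and>
     (\<exists>\<eta> :: real \<Rightarrow> real. homeomorphic_map (top_of_set {0..}) (top_of_set {0..}) \<eta> \<and>
        (\<forall>x\<in>mspace m. \<forall>y\<in>mspace m. \<forall>z\<in>mspace m. \<forall>t\<ge>0.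
           mdist m x y \<le> t * mdist m x z \<longrightarrow> mdist m' (f x) (f y) \<le> \<eta> t * mdist m' (f x) (f z)))"

definition spt :: "'a metric \<Rightarrow> 'a measure \<Rightarrow> 'a set" where
  "spt m \<mu> = {x \<in> mspace m. \<forall>U. openin (mtopology_of m) U \<and> x \<in> U \<longrightarrow> 0 < emeasure \<mu> U}"

text \<open>Here \<open>f\<close> is defined on \<open>spt m \<mu>\<close>, and \<open>B\<close> is sent to \<open>\<mu> {x \<in> spt m \<mu>. f x \<in> B}\<close>.\<close>

definition push_forward :: "'a metric \<Rightarrow> 'a measure \<Rightarrow> 'b metric \<Rightarrow> ('a \<Rightarrow> 'b) \<Rightarrow> 'b measure" where
  "push_forward m \<mu> m' f = distr (restrict_space \<mu> (spt m \<mu>)) (borel_of (mtopology_of m')) f"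

text \<open>The target \<open>m'\<close> ranges over all metric spaces whose carrier is a subset of the type of the
  domain. This is no restriction: any metric space that is in bijection with \<open>spt m \<mu>\<close> is
  isometric to such a space; see \<open>conformal_dim_le\<close> below.\<close>

definition conformal_dim :: "'a metric \<Rightarrow> 'a measure \<Rightarrow> ennreal" where
  "conformal_dim m \<mu> =
     (INF (m', f) \<in> {(m' :: 'a metric, f). quasisymmetric (submetric m (spt m \<mu>)) m' f}.
        hausdorff_dim_measure m' (push_forward m \<mu> m' f))"

lemma sets_borel_of_euclidean:
  "sets (borel_of (mtopology_of euclidean_metric)) = sets (borel :: 'a :: metric_space measure)"
  by (simp add: borel_of_def borel_def)

lemma spt_subset: "spt m \<mu> \<subseteq> mspace m"
  by (auto simp: spt_def)

lemma space_borel_of: "space (borel_of X) = topspace X"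
  unfolding borel_of_def by (rule space_measure_of) (auto dest: openin_subset)

lemma sets_borel_of: "sets (borel_of X) = sigma_sets (topspace X) {U. openin X U}"
  unfolding borel_of_def by (rule sets_measure_of) (auto dest: openin_subset)

lemma continuous_map_measurable:
  assumes "continuous_map X Y f"
  shows "f \<in> measurable (borel_of X) (borel_of Y)"
proof (unfold borel_of_def[of Y], rule measurable_measure_of)
  show "f \<in> space (borel_of X) \<rightarrow> topspace Y"
    using assms by (auto simp: space_borel_of continuous_map_def)
next
  fix U assume "U \<in> {U. openin Y U}"
  then have "openin X {x \<in> topspace X. f x \<in> U}"
    using assms by (simp add: continuous_map_def)
  moreover have "f -` U \<inter> space (borel_of X) = {x \<in> topspace X. f x \<in> U}"
    by (auto simp: space_borel_of)
  ultimately show "f -` U \<inter> space (borel_of X) \<in> sets (borel_of X)"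
    by (auto simp: sets_borel_of)
qed (auto dest: openin_subset)

lemma closedin_spt: "closedin (mtopology_of m) (spt m \<mu>)"
proof -
  let ?X = "mtopology_of m"
  have "topspace ?X - spt m \<mu> = \<Union>{U. openin ?X U \<and> emeasure \<mu> U = 0}"
  proof (intro set_eqI iffI)
    fix x assume "x \<in> topspace ?X - spt m \<mu>"
    then obtain U where "openin ?X U" "x \<in> U" "emeasure \<mu> U = 0"
      by (auto simp: spt_def not_gr_zero)
    then show "x \<in> \<Union>{U. openin ?X U \<and> emeasure \<mu> U = 0}" by blast
  next
    fix x assume "x \<in> \<Union>{U. openin ?X U \<and> emeasure \<mu> U = 0}"
    then obtain U where U: "openin ?X U" "x \<in> U" "emeasure \<mu> U = 0" by blast
    then have "x \<in> topspace ?X" using openin_subset by blast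
    moreover have "x \<notin> spt m \<mu>" using U unfolding spt_def by (metis (mono_tags) mem_Collect_eq less_irrefl)
    ultimately show "x \<in> topspace ?X - spt m \<mu>" by blast
  qed
  moreover have "openin ?X (\<Union>{U. openin ?X U \<and> emeasure \<mu> U = 0})"
    by (rule openin_Union) auto
  ultimately have "openin ?X (topspace ?X - spt m \<mu>)"
    by (simp only:)
  then show ?thesis
    using spt_subset[of m \<mu>] by (simp add: closedin_def)
qed

lemma mdiam_isometry:
  assumes "\<And>x y. x \<in> U \<Longrightarrow> y \<in> U \<Longrightarrow> mdist m' (g x) (g y) = mdist m x y"
  shows "mdiam m' (g ` U) = mdiam m U"
  unfolding mdiam_def image_comp o_def using assms by (auto intro!: SUP_cong)

lemma hausdorff_dim_isometry_le:
  assumes iso: "\<And>x y. x \<in> mspace m \<Longrightarrow> y \<in> mspace m \<Longrightarrow> mdist m' (g x) (g y) = mdist m x y"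
    and img: "g ` mspace m \<subseteq> mspace m'"
  shows "hausdorff_dim m' (g ` A) \<le> hausdorff_dim m A"
proof -
  have pre: "hausdorff_premeasure m' s \<delta> (g ` A) \<le> hausdorff_premeasure m s \<delta> A" for s \<delta>
    unfolding hausdorff_premeasure_def
  proof (rule INF_mono)
    fix U :: "nat \<Rightarrow> 'a set"
    assume U: "U \<in> {U. (\<forall>i. U i \<subseteq> mspace m \<and> mdiam m (U i) \<le> ennreal \<delta>) \<and> A \<subseteq> (\<Union>i. U i)}"
    have eq: "mdiam m' (g ` U i) = mdiam m (U i)" for i
      by (rule mdiam_isometry) (use U iso in blast)
    have "(\<lambda>i. g ` U i) \<in> {U. (\<forall>i. U i \<subseteq> mspace m' \<and> mdiam m' (U i) \<le> ennreal \<delta>) \<and> g ` A \<subseteq> (\<Union>i. U i)}"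
    proof (intro CollectI conjI allI)
      show "g ` U i \<subseteq> mspace m'" "mdiam m' (g ` U i) \<le> ennreal \<delta>" for i
        using U img by (auto simp: eq)
      show "g ` A \<subseteq> (\<Union>i. g ` U i)"
        using U by blast
    qed
    moreover have "(\<Sum>i. diam_power m' s (g ` U i)) = (\<Sum>i. diam_power m s (U i))"
      by (simp only: diam_power_def eq image_is_empty)
    ultimately show "\<exists>V\<in>{U. (\<forall>i. U i \<subseteq> mspace m' \<and> mdiam m' (U i) \<le> ennreal \<delta>) \<and> g ` A \<subseteq> (\<Union>i. U i)}.
        (\<Sum>i. diam_power m' s (V i)) \<le> (\<Sum>i. diam_power m s (U i))"
      by (intro bexI[of _ "\<lambda>i. g ` U i"]) simp_all
  qed
  have "hausdorff_measure m' s (g ` A) \<le> hausdorff_measure m s A" for s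
    unfolding hausdorff_measure_def by (rule SUP_mono) (use pre in blast)
  then have "hausdorff_measure m s A = 0 \<Longrightarrow> hausdorff_measure m' s (g ` A) = 0" for s
    by (metis le_zero_eq)
  then show ?thesis
    unfolding hausdorff_dim_def by (intro INF_superset_mono) auto
qed

lemma conformal_dim_le:
  fixes m :: "'a metric" and m' :: "'b metric" and f :: "'a \<Rightarrow> 'b"
  assumes \<mu>: "sets \<mu> = sets (borel_of (mtopology_of m))"
    and qs: "quasisymmetric (submetric m (spt m \<mu>)) m' f"
  shows "conformal_dim m \<mu> \<le> hausdorff_dim_measure m' (push_forward m \<mu> m' f)"
proof -
  define S where "S = spt m \<mu>"
  define n :: "'a metric" where "n = metric (S, \<lambda>x y. mdist m' (f x) (f y))"
  have S: "S \<subseteq> mspace m" "mspace (submetric m S) = S"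
    unfolding S_def using spt_subset[of m \<mu>] by (auto simp: Int_absorb2)
  have top_S: "topspace (mtopology_of (submetric m S)) = S"
    using S(2) by simp
  have hom: "homeomorphic_map (mtopology_of (submetric m S)) (mtopology_of m') f"
    using qs by (simp add: quasisymmetric_def S_def)
  then have bij: "f ` S = mspace m'" "inj_on f S"
    using homeomorphic_imp_surjective_map[OF hom] homeomorphic_imp_injective_map[OF hom] S by auto
  interpret n: Metric_space S "\<lambda>x y. mdist m' (f x) (f y)"
  proof
    fix x y z assume "x \<in> S" "y \<in> S"
    then show "(mdist m' (f x) (f y) = 0) = (x = y)"
      using bij by (metis image_eqI inj_on_eq_iff mdist_zero)
    assume "z \<in> S"
    then show "mdist m' (f x) (f z) \<le> mdist m' (f x) (f y) + mdist m' (f y) (f z)"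
      using \<open>x \<in> S\<close> \<open>y \<in> S\<close> bij by (metis image_eqI mdist_triangle)
  qed (simp_all add: mdist_commute)
  have n: "mspace n = S" "mdist n = (\<lambda>x y. mdist m' (f x) (f y))"
    by (simp_all add: n_def n.mspace_metric n.mdist_metric)
  have top_n: "mtopology_of n = n.mtopology"
    by (simp add: mtopology_of_def n)
  interpret nm: Metric_space12 S "\<lambda>x y. mdist m' (f x) (f y)" "mspace m'" "mdist m'"
    by (simp add: Metric_space12_def n.Metric_space_axioms)
  have top_m': "mtopology_of m' = nm.M2.mtopology"
    by (simp add: mtopology_of_def)
  have iso: "homeomorphic_map (mtopology_of n) (mtopology_of m') f"
    unfolding top_n top_m'
    by (rule nm.isometry_imp_homeomorphic_map) (use bij in auto)
  obtain g where g: "homeomorphic_maps (mtopology_of n) (mtopology_of m') f g"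
    using iso unfolding homeomorphic_map_maps by (rule exE)
  have iso_g: "homeomorphic_map (mtopology_of m') (mtopology_of n) g"
    using g unfolding homeomorphic_maps_map by (elim conjE)
  have gf: "homeomorphic_map (mtopology_of (submetric m S)) (mtopology_of n) (g \<circ> f)"
    by (rule homeomorphic_map_compose[OF hom iso_g])
  have fg: "g (f x) = x" if "x \<in> S" for x
    using g that by (simp add: homeomorphic_maps_def n)
  have gS: "g y \<in> S" "f (g y) = y" if "y \<in> mspace m'" for y
    using that fg by (auto simp: bij(1)[symmetric])
  have idn: "homeomorphic_map (mtopology_of (submetric m S)) (mtopology_of n) id"
    by (rule homeomorphic_map_eq[OF gf]) (use S fg in auto)
  have "quasisymmetric (submetric m S) n id"
    using qs idn S by (auto simp: quasisymmetric_def S_def[symmetric] n)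
  then have "conformal_dim m \<mu> \<le> hausdorff_dim_measure n (push_forward m \<mu> n id)"
    unfolding conformal_dim_def S_def by (intro INF_lower2[of "(n, id)"]) auto
  also have "\<dots> \<le> hausdorff_dim_measure m' (push_forward m \<mu> m' f)"
    unfolding hausdorff_dim_measure_def
  proof (rule INF_mono)
    fix A assume A: "A \<in> {A \<in> sets (borel_of (mtopology_of m')).
      emeasure (push_forward m \<mu> m' f) (mspace m' - A) = 0}"
    have A_sub: "A \<subseteq> mspace m'"
      using A sets.sets_into_space[of A "borel_of (mtopology_of m')"] by (simp add: space_borel_of)
    define R where "R = restrict_space \<mu> S"
    have "S \<in> sets \<mu>"
    proof -
      have "topspace (mtopology_of m) - S \<in> sets (borel_of (mtopology_of m))"
        using closedin_spt[of m \<mu>] by (auto simp: sets_borel_of S_def closedin_def)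
      then have "topspace (mtopology_of m) - (topspace (mtopology_of m) - S) \<in> sets \<mu>"
        unfolding \<mu> using sets.compl_sets space_borel_of by metis
      then show ?thesis using S by (simp add: double_diff)
    qed
    have space_\<mu>: "space \<mu> = mspace m"
      using sets_eq_imp_space_eq[OF \<mu>] by (simp add: space_borel_of)
    have space_R: "space R = S"
      using S by (auto simp: R_def space_restrict_space space_\<mu>)
    have "continuous_map (mtopology_of (submetric m S)) X h \<Longrightarrow> h \<in> measurable R (borel_of X)"
      for X :: "'c topology" and h
    proof -
      assume c: "continuous_map (mtopology_of (submetric m S)) X h"
      have sub: "mtopology_of (submetric m S) = subtopology (mtopology_of m) S"
        by (simp add: mtopology_of_submetric)
      show ?thesis
        unfolding borel_of_def
      proof (rule measurable_measure_of)
        show "h \<in> space R \<rightarrow> topspace X"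
          using c S by (auto simp: space_R continuous_map_def)
      next
        fix U assume "U \<in> {U. openin X U}"
        then have "openin (subtopology (mtopology_of m) S) {x \<in> S. h x \<in> U}"
          using c unfolding continuous_map_def top_S sub[symmetric] by simp
        then obtain V where V: "openin (mtopology_of m) V" "{x \<in> S. h x \<in> U} = V \<inter> S"
          by (auto simp: openin_subtopology)
        have "V \<in> sets \<mu>" using V by (auto simp: \<mu> sets_borel_of)
        moreover have "h -` U \<inter> space R = S \<inter> V" using V(2) by (auto simp: space_R)
        ultimately show "h -` U \<inter> space R \<in> sets R"
          by (auto simp: R_def sets_restrict_space)
      qed (auto dest: openin_subset)
    qed
    note meas = this
    have fR: "f \<in> measurable R (borel_of (mtopology_of m'))"
      using hom homeomorphic_imp_continuous_map by (intro meas) blast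
    have "(\<lambda>x. x) \<in> measurable R (borel_of (mtopology_of n))"
      using idn homeomorphic_imp_continuous_map unfolding id_def by (intro meas) blast
    then have idR: "id \<in> measurable R (borel_of (mtopology_of n))" by (simp add: id_def)
    define B where "B = f -` A \<inter> S"
    have "f \<in> measurable (borel_of (mtopology_of n)) (borel_of (mtopology_of m'))"
      using iso homeomorphic_imp_continuous_map by (intro continuous_map_measurable) blast
    then have B: "B \<in> sets (borel_of (mtopology_of n))"
      using A measurable_sets[of f "borel_of (mtopology_of n)" _ A] by (simp add: B_def space_borel_of n)
    have "mspace m' - A \<in> sets (borel_of (mtopology_of m'))"
      using A sets.compl_sets[of A "borel_of (mtopology_of m')"] by (simp add: space_borel_of)
    then have 1: "emeasure (push_forward m \<mu> m' f) (mspace m' - A) = emeasure R (f -` (mspace m' - A) \<inter> S)"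
      unfolding push_forward_def S_def[symmetric] R_def[symmetric] by (simp add: emeasure_distr fR space_R)
    have "mspace n - B \<in> sets (borel_of (mtopology_of n))"
      using B sets.compl_sets[of B "borel_of (mtopology_of n)"] by (simp add: space_borel_of)
    then have 2: "emeasure (push_forward m \<mu> n id) (mspace n - B) = emeasure R (S - B)"
      unfolding push_forward_def S_def[symmetric] R_def[symmetric]
      by (simp add: emeasure_distr idR space_R n Int_absorb2)
    have "f -` (mspace m' - A) \<inter> S = S - B"
      using bij by (auto simp: B_def)
    with 1 2 A have null: "emeasure (push_forward m \<mu> n id) (mspace n - B) = 0"
      by simp
    have "B = g ` A"
      using A_sub gS fg by (force simp: B_def)
    moreover have "hausdorff_dim n (g ` A) \<le> hausdorff_dim m' A"
      by (rule hausdorff_dim_isometry_le) (auto simp: n gS)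
    ultimately show "\<exists>B\<in>{A \<in> sets (borel_of (mtopology_of n)).
        emeasure (push_forward m \<mu> n id) (mspace n - A) = 0}. hausdorff_dim n B \<le> hausdorff_dim m' A"
      using B null by auto
  qed
  finally show ?thesis .
qed

end

theory Submission
  imports Defs
begin

text \<open>
  The points of the line can be kept where they are: it suffices to replace the Euclidean metric by
  a quasisymmetrically equivalent one that makes almost every point, in the sense of \<open>\<nu>\<close>, lie in a
  set of small Hausdorff dimension.

  Such a metric comes from a self-similar measure. Fix \<open>B \<ge> 1\<close> and let every triadic interval, of
  any length \<open>3\<^sup>-\<^sup>n\<close> with \<open>n\<close> an integer, split its mass among its three children in the proportion
  \<open>1 : B : 1\<close>. The two outer children receive equal shares, so the masses of neighbouring intervals
  of equal length differ at most by the factor \<open>B\<close> (\<open>weight_adjacent\<close>). Hence the measure is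
  doubling, and its distribution function \<open>warp\<close> is a quasisymmetric map of the line
  (\<open>warp_quasisymmetric\<close>). In other words, \<open>\<bar>warp x - warp y\<bar>\<close> is a metric that is quasisymmetrically
  equivalent to the Euclidean one, and an interval has its mass as its diameter.

  If \<open>B\<close> is large, the outer children are very light. About two thirds of the triadic digits of a
  Lebesgue-typical point belong to outer children, so the mass of the interval of generation \<open>n\<close>
  around the point falls below \<open>r\<^sup>n\<close>, where \<open>r\<close> can be made as small as desired. Therefore the
  set \<open>light r\<close> of points where this happens for infinitely many \<open>n\<close> has full Lebesgue measure
  (\<open>complement_light_null\<close>). It is also small in the new metric: a bounded window meets about \<open>3\<^sup>n\<close>
  intervals of generation \<open>n\<close>, and those of diameter at most \<open>r\<^sup>n\<close> contribute about \<open>(3 r\<^sup>s)\<^sup>n\<close> to the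
  \<open>s\<close>-dimensional Hausdorff sum, which is summable if \<open>3 r\<^sup>s < 1\<close> (\<open>hausdorff_measure_light\<close>).

  Finally, \<open>\<nu>\<close> need not be related to Lebesgue measure, but a translation removes the difference.
  For each \<open>x\<close>, Lebesgue-almost every \<open>\<omega>\<close> moves \<open>x\<close> to a point \<open>x + \<omega>\<close> of \<open>light r\<close>; by Fubini's
  theorem some \<open>\<omega>\<close> does so for \<open>\<nu>\<close>-almost every \<open>x\<close> (\<open>exists_null_translate\<close>). The metric
  \<open>\<bar>warp (x + \<omega>) - warp (y + \<omega>)\<bar>\<close>, restricted to the support of \<open>\<nu>\<close>, then shows that the conformal
  dimension is at most \<open>s\<close>, for every \<open>s > 0\<close>.
\<close>

section \<open>Real numbers and integers\<close>

lemma int_steps_le: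
  fixes f :: "int \<Rightarrow> real"
  assumes step: "\<And>n. f n \<le> f (n + 1)" and "m \<le> n"
  shows "f m \<le> f n"
  using \<open>m \<le> n\<close>
proof (induction n rule: int_ge_induct)
  case (step i)
  then show ?case using assms(1)[of i] by simp
qed simp

lemma floor_triple:
  fixes y :: real
  obtains d where "d \<in> {0, 1, 2}" "\<lfloor>3 * y\<rfloor> = 3 * \<lfloor>y\<rfloor> + d"
proof
  show "\<lfloor>3 * y\<rfloor> - 3 * \<lfloor>y\<rfloor> \<in> {0, 1, 2}" by simp linarith
qed simp

lemma sum_triples:
  fixes g :: "int \<Rightarrow> real"
  assumes "a \<le> b"
  shows "(\<Sum>k\<in>{3 * a..<3 * b}. g k) = (\<Sum>k\<in>{a..<b}. g (3 * k) + g (3 * k + 1) + g (3 * k + 2))"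
  using assms
proof (induction b rule: int_ge_induct)
  case (step b)
  have "{3 * a..<3 * (b + 1)} = insert (3 * b) (insert (3 * b + 1) (insert (3 * b + 2) {3 * a..<3 * b}))"
    "{a..<b + 1} = insert b {a..<b}"
    using step.hyps by auto
  then show ?case using step.IH by simp
qed simp

lemma power_powr_swap:
  fixes c u :: real
  assumes "0 < c"
  shows "(c ^ n) powr u = (c powr u) ^ n"
  using assms by (simp add: powr_realpow[symmetric] powr_powr mult.commute)

lemma triadic_scale:
  fixes r :: real
  assumes "0 < r"
  obtains n :: int where "r \<le> 3 powr - n" "3 powr - n < 3 * r"
proof -
  define n where "n = - \<lceil>log 3 r\<rceil>"
  have r: "3 powr log 3 r = r" using assms by simp
  have "3 powr log 3 r \<le> 3 powr - real_of_int n"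
    by (simp add: n_def del: powr_log_cancel)
  moreover have "3 powr - real_of_int n < 3 powr (log 3 r + 1)"
    by (simp add: n_def) linarith
  moreover have "3 powr (log 3 r + 1) = 3 * r"
    unfolding powr_add r by simp
  ultimately show ?thesis using that[of n] by (simp only: r of_int_minus)
qed

text \<open>The control functions of quasisymmetric maps that are obtained by comparing scales have this
  form: one power governs large ratios and the other one small ratios.\<close>
lemma homeomorphic_map_gauge:
  fixes a b c C :: real
  assumes "0 < a" "0 < b" "0 < c" "0 < C"
  shows "homeomorphic_map (top_of_set {0..}) (top_of_set {0..})
    (\<lambda>t. C * ((c * t) powr a + (c * t) powr b))"
proof -
  let ?g = "\<lambda>t. C * ((c * t) powr a + (c * t) powr b)"
  have cont: "continuous_on {0..} ?g"
    using assms by (intro continuous_on_mult continuous_on_add continuous_on_powr' continuous_intros) auto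
  have less: "?g s < ?g t" if "0 \<le> s" "s < t" for s t
    using that assms by (intro mult_strict_left_mono add_strict_mono powr_less_mono2) auto
  then have inj: "inj_on ?g {0..}"
    by (intro linorder_inj_onI') (metis atLeast_iff less_irrefl)
  have "?g ` {0..} = {0..}"
  proof (intro equalityI subsetI)
    fix y assume "y \<in> ?g ` {0..}"
    then show "y \<in> {0..}" using assms by auto
  next
    fix y :: real assume y: "y \<in> {0..}"
    define T where "T = (y / C) powr (1 / a) / c"
    have "y = C * (c * T) powr a"
      using y assms by (simp add: T_def powr_powr)
    also have "\<dots> \<le> ?g T" using assms by simp
    finally have "y \<le> ?g T" .
    moreover have "?g 0 \<le> y" using y by simp
    moreover have "0 \<le> T" using assms by (simp add: T_def)
    ultimately obtain t where "0 \<le> t" "?g t = y"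
      using IVT'[of ?g 0 y T] continuous_on_subset[OF cont, of "{0..T}"] by auto
    then show "y \<in> ?g ` {0..}" by force
  qed
  moreover have "path_connected {0::real..}"
    by (simp add: convex_imp_path_connected)
  ultimately obtain h where "homeomorphism {0..} {0..} ?g h"
    using homeomorphism_into_1d[OF _ cont _ inj] by blast
  then show ?thesis
    unfolding homeomorphic_map_maps homeomorphic_maps_def homeomorphism_def
    by (intro exI[of _ h]) auto
qed

section \<open>Hausdorff measure of limsup sets\<close>

text \<open>A Borel--Cantelli lemma for Hausdorff measure. If every point of \<open>A\<close> is covered in infinitely
  many stages, then the stages from \<open>N\<close> on still cover \<open>A\<close>, and they contribute only the tail of a
  convergent series.\<close>
lemma hausdorff_measure_limsup_eq_0:
  fixes V :: "nat \<Rightarrow> nat \<Rightarrow> 'a set" and r :: "nat \<Rightarrow> real"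
  assumes s: "0 < s"
    and V: "\<And>n k. k < L n \<Longrightarrow> V n k \<subseteq> mspace m \<and> mdiam m (V n k) \<le> ennreal (r n)"
    and r: "\<And>n. 0 \<le> r n" "r \<longlonglongrightarrow> 0"
    and summable: "summable (\<lambda>n. real (L n) * r n powr s)"
    and A: "\<And>x N. x \<in> A \<Longrightarrow> \<exists>n\<ge>N. \<exists>k<L n. x \<in> V n k"
  shows "hausdorff_measure m s A = 0"
proof -
  have power: "diam_power m s (V n k) \<le> ennreal (r n powr s)" if "k < L n" for n k
  proof -
    have "enn2real (mdiam m (V n k)) \<le> r n"
      using V[OF that] r(1)[of n] enn2real_leI by blast
    then show ?thesis
      using s by (auto simp: diam_power_def intro!: ennreal_leI powr_mono2)
  qed
  have bound: "hausdorff_premeasure m s \<delta> A \<le> ennreal (\<Sum>n. real (L (n + N)) * r (n + N) powr s)"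
    if N: "\<And>n. n \<ge> N \<Longrightarrow> r n \<le> \<delta>" for \<delta> N
  proof -
    \<comment> \<open>The double sequence of stages and indices, padded by empty sets, is arranged in one sequence.\<close>
    define W where "W = (\<lambda>(n, k). if k < L (n + N) then V (n + N) k else {})"
    define U where "U = (\<lambda>i. W (prod_decode i))"
    have "W p \<subseteq> mspace m \<and> mdiam m (W p) \<le> ennreal \<delta>" for p
    proof (cases "snd p < L (fst p + N)")
      case True
      then show ?thesis
        using V[OF True] ennreal_leI[OF N[of "fst p + N"]] by (auto simp: W_def case_prod_unfold)
    next
      case False
      then show ?thesis by (auto simp: W_def case_prod_unfold mdiam_def bot_ennreal)
    qed
    moreover have "A \<subseteq> (\<Union>i. U i)"
    proof
      fix x assume "x \<in> A"
      then obtain n k where nk: "N \<le> n" "k < L n" "x \<in> V n k" using A by blast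
      then have "x \<in> U (prod_encode (n - N, k))" by (simp add: U_def W_def)
      then show "x \<in> (\<Union>i. U i)" by blast
    qed
    ultimately have "hausdorff_premeasure m s \<delta> A \<le> (\<Sum>i. diam_power m s (U i))"
      unfolding hausdorff_premeasure_def by (intro INF_lower) (auto simp: U_def)
    also have "\<dots> = (\<Sum>n. \<Sum>k. diam_power m s (W (n, k)))"
      unfolding U_def by (rule suminf_ennreal_2dimen[of _ "\<lambda>p. diam_power m s (W p)"]) simp
    also have "\<dots> \<le> (\<Sum>n. ennreal (real (L (n + N)) * r (n + N) powr s))"
    proof (intro suminf_le allI)
      fix n
      have "(\<Sum>k. diam_power m s (W (n, k))) = (\<Sum>k<L (n + N). diam_power m s (W (n, k)))"
        by (rule suminf_finite) (auto simp: W_def diam_power_def)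
      also have "\<dots> \<le> (\<Sum>k<L (n + N). ennreal (r (n + N) powr s))"
        by (intro sum_mono) (use power in \<open>auto simp: W_def\<close>)
      also have "\<dots> = ennreal (real (L (n + N)) * r (n + N) powr s)"
        by (simp add: ennreal_mult ennreal_of_nat_eq_real_of_nat)
      finally show "(\<Sum>k. diam_power m s (W (n, k))) \<le> ennreal (real (L (n + N)) * r (n + N) powr s)" .
    qed auto
    also have "\<dots> = ennreal (\<Sum>n. real (L (n + N)) * r (n + N) powr s)"
      using summable by (intro suminf_ennreal2) (auto simp: summable_iff_shift[of "\<lambda>n. real (L n) * r n powr s"])
    finally show ?thesis .
  qed
  have "hausdorff_premeasure m s \<delta> A = 0" if \<delta>: "0 < \<delta>" for \<delta>
  proof -
    obtain N0 where N0: "\<And>n. n \<ge> N0 \<Longrightarrow> r n \<le> \<delta>"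
      using order_tendstoD(2)[OF r(2) \<delta>] unfolding eventually_sequentially
      by (metis less_imp_le)
    have "(\<lambda>N. ennreal (\<Sum>n. real (L (n + N)) * r (n + N) powr s)) \<longlonglongrightarrow> ennreal 0"
      using suminf_exist_split2[OF summable] by (intro tendsto_ennrealI)
    moreover have "\<forall>N\<ge>N0. hausdorff_premeasure m s \<delta> A \<le> ennreal (\<Sum>n. real (L (n + N)) * r (n + N) powr s)"
      using bound N0 by auto
    ultimately have "hausdorff_premeasure m s \<delta> A \<le> ennreal 0"
      by (intro LIMSEQ_le_const[of _ _ "hausdorff_premeasure m s \<delta> A"]) auto
    then show ?thesis by simp
  qed
  then show ?thesis
    unfolding hausdorff_measure_def by (auto intro!: antisym SUP_least)
qed

section \<open>Translating a measure away from a Lebesgue null set\<close>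

lemma sigma_finite_of_locally_finite:
  fixes \<nu> :: "'a :: second_countable_topology measure"
  assumes borel: "sets \<nu> = sets borel"
    and locally_finite: "\<forall>x. \<exists>U. open U \<and> x \<in> U \<and> emeasure \<nu> U < \<infinity>"
  shows "sigma_finite_measure \<nu>"
proof -
  let ?F = "{U. open U \<and> emeasure \<nu> U < \<infinity>}"
  obtain G where G: "G \<subseteq> ?F" "countable G" "\<Union>G = \<Union>?F"
    by (rule Lindelof_openin[of ?F UNIV]) (auto simp: subtopology_UNIV)
  have "\<Union>?F = UNIV"
    using locally_finite by blast
  then have "\<Union>?F = space \<nu>"
    using sets_eq_imp_space_eq[OF borel] by simp
  with G have "\<Union>G = space \<nu>" by simp
  moreover have "G \<subseteq> sets \<nu>" "\<forall>U\<in>G. emeasure \<nu> U \<noteq> \<infinity>"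
    using G(1) by (auto simp: borel)
  ultimately show ?thesis
    using G(2) by (intro sigma_finite_measure.intro exI[of _ G]) blast
qed

text \<open>Fubini's theorem for the product with Lebesgue measure, applied to the set of all \<open>(x, \<omega>)\<close> with
  \<open>x + \<omega> \<in> Z\<close>. Its vertical sections are translates of \<open>Z\<close>, hence Lebesgue null, so almost all of its
  horizontal sections are null for \<open>\<nu>\<close>.\<close>
lemma exists_null_translate:
  fixes \<nu> :: "real measure" and Z :: "real set"
  assumes borel: "sets \<nu> = sets borel" and "sigma_finite_measure \<nu>"
    and Z: "Z \<in> null_sets lborel"
  obtains \<omega> where "emeasure \<nu> {x. x + \<omega> \<in> Z} = 0"
proof -
  interpret \<nu>: sigma_finite_measure \<nu> by fact
  interpret P: pair_sigma_finite \<nu> "lborel :: real measure" ..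
  have [measurable]: "Z \<in> sets borel" using Z by auto
  define Q where "Q = {p. fst p + snd p \<in> Z}"
  have "(\<lambda>p. fst p + snd p) \<in> measurable (\<nu> \<Otimes>\<^sub>M lborel) (borel :: real measure)"
    by (subst measurable_cong_sets[OF sets_pair_measure_cong[OF borel sets_lborel] refl]) measurable
  from measurable_sets[OF this \<open>Z \<in> sets borel\<close>] have Q: "Q \<in> sets (\<nu> \<Otimes>\<^sub>M lborel)"
    using sets_eq_imp_space_eq[OF borel] by (simp add: Q_def space_pair_measure vimage_def)
  have "emeasure lborel (Pair x -` Q) = 0" for x
  proof -
    have "emeasure lborel (Pair x -` Q) = emeasure (distr lborel borel ((+) x)) Z"
      by (subst emeasure_distr) (auto simp: Q_def vimage_def)
    also have "\<dots> = 0"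
      using Z by (subst lborel_distr_plus) auto
    finally show ?thesis .
  qed
  then have "(\<integral>\<^sup>+ \<omega>. emeasure \<nu> ((\<lambda>x. (x, \<omega>)) -` Q) \<partial>lborel) = 0"
    using P.emeasure_pair_measure_alt2[OF Q] lborel.emeasure_pair_measure_alt[OF Q] by simp
  then have "AE \<omega> in lborel. emeasure \<nu> ((\<lambda>x. (x, \<omega>)) -` Q) = 0"
    using P.measurable_emeasure_Pair2[OF Q] by (simp add: nn_integral_0_iff_AE)
  moreover have "\<not> (AE \<omega> in lborel :: real measure. False)"
    by (subst AE_iff_measurable[of UNIV]) auto
  ultimately obtain \<omega> where "emeasure \<nu> ((\<lambda>x. (x, \<omega>)) -` Q) = 0"
    using frequently_ex[of "\<lambda>\<omega>. emeasure \<nu> ((\<lambda>x. (x, \<omega>)) -` Q) = 0" "ae_filter lborel"]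
      eventually_frequently[of "ae_filter lborel"] by (auto simp: trivial_limit_def)
  then show ?thesis using that[of \<omega>] by (simp add: Q_def vimage_def)
qed

section \<open>The dimension of a measure on its support\<close>

lemma sets_borel_of_subtopology:
  fixes S :: "'a::topological_space set"
  assumes "S \<in> sets borel"
  shows "sets (borel_of (top_of_set S)) = sets (restrict_space borel S)"
proof -
  have "sets (restrict_space borel S) = sigma_sets S ((\<inter>) S ` {U. open U})"
    using assms unfolding sets_restrict_space sets_borel by (intro sigma_sets_Int) auto
  moreover have "(\<inter>) S ` {U. open U} = {U. openin (top_of_set S) U}"
    by (auto simp: openin_open)
  ultimately show ?thesis by (simp add: sets_borel_of)
qed

text \<open>For a metric that induces the usual topology on the support, the identity pushes \<open>\<nu>\<close> forward to
  its own restriction, so that a set carrying \<open>\<nu>\<close> can be used directly to bound the dimension.\<close>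
lemma hausdorff_dim_measure_id_le:
  fixes \<nu> :: "real measure" and m' :: "real metric"
  assumes borel: "sets \<nu> = sets borel"
    and top: "mtopology_of m' = top_of_set (spt euclidean_metric \<nu>)"
    and A: "A \<in> sets borel" "emeasure \<nu> (- A) = 0"
    and s: "0 < s" "hausdorff_measure m' s (spt euclidean_metric \<nu> \<inter> A) = 0"
  shows "hausdorff_dim_measure m' (push_forward euclidean_metric \<nu> m' id) \<le> ennreal s"
proof -
  define S where "S = spt euclidean_metric \<nu>"
  have m': "mspace m' = S"
    using top topspace_mtopology_of[of m'] by (simp add: S_def)
  have S: "S \<in> sets borel"
    using closedin_spt[of euclidean_metric \<nu>] by (simp add: S_def borel_closed)
  have space: "space \<nu> = UNIV" using sets_eq_imp_space_eq[OF borel] by simp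
  have sets': "sets (borel_of (mtopology_of m')) = sets (restrict_space \<nu> S)"
    unfolding top S_def[symmetric] sets_borel_of_subtopology[OF S]
    by (simp add: sets_restrict_space borel)
  have id: "id \<in> measurable (restrict_space \<nu> S) (borel_of (mtopology_of m'))"
    unfolding id_def by (subst measurable_cong_sets[OF refl sets']) simp
  have sub: "S \<inter> A \<in> sets (borel_of (mtopology_of m'))" "S - A \<in> sets (borel_of (mtopology_of m'))"
    using A S unfolding sets' by (auto simp: sets_restrict_space_iff borel space)
  have "emeasure (push_forward euclidean_metric \<nu> m' id) (mspace m' - S \<inter> A)
      = emeasure (restrict_space \<nu> S) (S - A)"
    using emeasure_distr[OF id sub(2)]
    by (simp add: push_forward_def S_def[symmetric] m' space_restrict_space space Diff_Int2 Int_absorb2 Diff_Int)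
  also have "\<dots> = emeasure \<nu> (S - A)"
    using S by (intro emeasure_restrict_space) (auto simp: borel space)
  also have "\<dots> \<le> emeasure \<nu> (- A)"
    using A by (intro emeasure_mono) (auto simp: borel)
  finally have "emeasure (push_forward euclidean_metric \<nu> m' id) (mspace m' - S \<inter> A) = 0"
    using A by simp
  then have "hausdorff_dim_measure m' (push_forward euclidean_metric \<nu> m' id) \<le> hausdorff_dim m' (S \<inter> A)"
    unfolding hausdorff_dim_measure_def using sub by (intro INF_lower) auto
  also have "\<dots> \<le> ennreal s"
    unfolding hausdorff_dim_def using s by (intro INF_lower) (auto simp: S_def)
  finally show ?thesis .
qed

section \<open>A doubling measure on the line\<close>

text \<open>The parameter \<open>B\<close> is the ratio between the mass of a middle child and that of an outer child.\<close>
locale triadic_weights =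
  fixes B :: real
  assumes B_ge_1: "1 \<le> B"
begin

text \<open>The mass of the unit interval \<open>[k, k + 1)\<close>. For \<open>k \<ge> 0\<close> it is \<open>B\<close> to the number of digits \<open>1\<close> in
  the triadic expansion of \<open>k\<close>. For \<open>k < 0\<close> division rounds downwards and the iteration stops at \<open>-1\<close>,
  the fixed point all of whose digits are \<open>2\<close>; the result is symmetric about the origin. In this
  normalization, tripling the line multiplies the measure by \<open>B + 2\<close>, so that the integers determine
  the measure at all triadic scales, small and large.\<close>
function weight :: "int \<Rightarrow> real" where
  "weight k = (if k = 0 \<or> k = -1 then 1 else (if k mod 3 = 1 then B else 1) * weight (k div 3))"
  by pat_completeness auto

termination
  by (relation "Wellfounded.measure (\<lambda>k. nat \<bar>k\<bar>)") auto

declare weight.simps [simp del]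

lemma weight_root [simp]: "weight 0 = 1" "weight (- 1) = 1"
  by (subst weight.simps, simp)+

lemma weight_child:
  assumes "d \<in> {0, 1, 2}"
  shows "weight (3 * k + d) = (if d = 1 then B else 1) * weight k"
proof (cases "3 * k + d = 0 \<or> 3 * k + d = -1")
  case True
  then have "(k = 0 \<and> d = 0) \<or> (k = -1 \<and> d = 2)"
    using assms by auto presburger+
  then show ?thesis by auto
next
  case False
  have "(3 * k + d) mod 3 = d" "(3 * k + d) div 3 = k"
    using assms by auto
  then show ?thesis using False by (subst weight.simps) simp
qed

lemma weight_pos: "0 < weight k"
  by (induction k rule: weight.induct) (subst weight.simps, use B_ge_1 in auto)

text \<open>Two neighbours are either siblings, and then the claim is about the proportion \<open>1 : B : 1\<close>, or the
  last child of \<open>j\<close> and the first child of \<open>j + 1\<close>. Both of the latter are outer children, so that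
  their ratio is that of their parents, and the induction applies.\<close>
lemma weight_adjacent: "weight k \<le> B * weight (k + 1) \<and> weight (k + 1) \<le> B * weight k"
proof (induction "nat \<bar>k\<bar>" arbitrary: k rule: less_induct)
  case less
  have pos: "0 < weight (k div 3)" "0 < weight (k div 3 + 1)" by (rule weight_pos)+
  have mono: "weight (k div 3) \<le> B * weight (k div 3)" "B * weight (k div 3) \<le> B * (B * weight (k div 3))"
    using pos B_ge_1 by (auto intro: mult_left_mono)
  have k: "k = 3 * (k div 3) + k mod 3" by simp
  have "k mod 3 = 0 \<or> k mod 3 = 1 \<or> k mod 3 = 2" by presburger
  then consider "k mod 3 = 0" | "k mod 3 = 1" | "k mod 3 = 2" by blast
  then show ?case
  proof cases
    case 1
    then have "weight k = weight (k div 3)" "weight (k + 1) = B * weight (k div 3)"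
      using weight_child[of 0 "k div 3"] weight_child[of 1 "k div 3"] k by auto
    then show ?thesis using mono by simp
  next
    case 2
    then have "weight k = B * weight (k div 3)" "weight (k + 1) = weight (k div 3)"
      using weight_child[of 1 "k div 3"] weight_child[of 2 "k div 3"] k
      by (auto simp: add.commute) (metis add.assoc one_add_one)
    then show ?thesis using mono by simp
  next
    case 3
    have *: "weight k = weight (k div 3)" "weight (k + 1) = weight (k div 3 + 1)"
      using 3 weight_child[of 2 "k div 3"] weight_child[of 0 "k div 3 + 1"] k
      by (auto simp: algebra_simps) (smt (verit))
    show ?thesis
    proof (cases "k = -1")
      case True
      then show ?thesis using B_ge_1 by simp
    next
      case False
      then have "nat \<bar>k div 3\<bar> < nat \<bar>k\<bar>" using 3 k by linarith
      from less[OF this] show ?thesis by (simp add: *)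
    qed
  qed
qed

text \<open>The distribution function at the integers, normalized to vanish at the origin.\<close>
definition cumul :: "int \<Rightarrow> real" where
  "cumul k = (\<Sum>j\<in>{0..<k}. weight j) - (\<Sum>j\<in>{k..<0}. weight j)"

lemma cumul_step: "cumul (k + 1) = cumul k + weight k"
proof (cases "0 \<le> k")
  case True
  then have "{0..<k+1} = insert k {0..<k}" by auto
  then show ?thesis using True by (simp add: cumul_def)
next
  case False
  then have "{k..<0} = insert k {k+1..<0}" by auto
  then show ?thesis using False by (simp add: cumul_def)
qed

lemma cumul_triple: "cumul (3 * k) = (B + 2) * cumul k"
proof -
  have step: "cumul (3 * (j + 1)) - cumul (3 * j) = (B + 2) * (cumul (j + 1) - cumul j)" for j
  proof -
    have "cumul (3 * (j + 1)) = cumul (3 * j) + weight (3 * j) + weight (3 * j + 1) + weight (3 * j + 2)"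
      using cumul_step[of "3 * j"] cumul_step[of "3 * j + 1"] cumul_step[of "3 * j + 2"]
      by (simp add: algebra_simps)
    then show ?thesis
      using weight_child[of 0 j] weight_child[of 1 j] weight_child[of 2 j] cumul_step[of j]
      by (simp add: algebra_simps)
  qed
  show ?thesis
  proof (induction k rule: int_induct[of _ 0])
    case base
    show ?case by (simp add: cumul_def)
  next
    case (step1 i)
    then show ?case using step[of i] by (simp add: algebra_simps)
  next
    case (step2 i)
    then show ?case using step[of "i - 1"] by (simp add: algebra_simps)
  qed
qed

lemma cumul_mono: "j \<le> k \<Longrightarrow> cumul j \<le> cumul k"
  by (rule int_steps_le) (simp add: cumul_step weight_pos less_imp_le)

abbreviation cell :: "int \<Rightarrow> real \<Rightarrow> int" where
  "cell n x \<equiv> \<lfloor>x * 3 powr n\<rfloor>"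

text \<open>The mass of the triadic interval of length \<open>3 powr - n\<close> around \<open>x\<close>. The generation \<open>n\<close> is an
  arbitrary integer because quasisymmetry compares all scales, the large ones included.\<close>
definition mass :: "int \<Rightarrow> real \<Rightarrow> real" where
  "mass n x = (B + 2) powr - n * weight (cell n x)"

text \<open>The distribution function at the left end point of that interval.\<close>
definition left_value :: "int \<Rightarrow> real \<Rightarrow> real" where
  "left_value n x = (B + 2) powr - n * cumul (cell n x)"

lemma mass_pos: "0 < mass n x"
  using B_ge_1 by (simp add: mass_def weight_pos)

lemma powr_shrink:
  fixes n :: int
  shows "(B + 2) powr - n = (B + 2) * (B + 2) powr - (n + 1)"
proof -
  have "(B + 2) * (B + 2) powr - (n + 1) = (B + 2) powr 1 * (B + 2) powr - (n + 1)"
    using B_ge_1 by simp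
  also have "\<dots> = (B + 2) powr (1 + - real_of_int (n + 1))"
    by (simp only: powr_add of_int_minus)
  finally show ?thesis by simp
qed

lemma cell_next:
  fixes n :: int
  obtains d where "d \<in> {0, 1, 2}" "cell (n + 1) x = 3 * cell n x + d"
proof -
  have "x * 3 powr (n + 1) = 3 * (x * 3 powr n)"
    by (simp add: powr_add)
  then show ?thesis using floor_triple[of "x * 3 powr n"] that by metis
qed

lemma mass_next:
  "mass n x \<le> (B + 2) * mass (n + 1) x" "(B + 2) * mass (n + 1) x \<le> B * mass n x"
proof -
  obtain d where d: "d \<in> {0, 1, 2}" "cell (n + 1) x = 3 * cell n x + d"
    by (rule cell_next)
  let ?f = "if d = 1 then B else 1"
  have "(B + 2) * mass (n + 1) x = (B + 2) powr - n * weight (cell (n + 1) x)"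
    using powr_shrink[of n] by (simp add: mass_def)
  also have "\<dots> = ?f * mass n x"
    using weight_child[OF d(1), of "cell n x"] unfolding d(2) by (simp add: mass_def)
  finally have *: "(B + 2) * mass (n + 1) x = ?f * mass n x" .
  show "mass n x \<le> (B + 2) * mass (n + 1) x" "(B + 2) * mass (n + 1) x \<le> B * mass n x"
    unfolding * using B_ge_1 mass_pos[of n x] by auto
qed

text \<open>Passing to a child divides the mass by \<open>B + 2\<close> at most and by \<open>(B + 2) / B\<close> at least.\<close>
lemma mass_scale:
  fixes m n :: int
  assumes "m \<le> n"
  shows "mass m x \<le> (B + 2) powr (n - m) * mass n x"
    and "mass n x \<le> (B / (B + 2)) powr (n - m) * mass m x"
  using assms
proof (induction n rule: int_ge_induct)
  case base
  show "mass m x \<le> (B + 2) powr (m - m) * mass m x" "mass m x \<le> (B / (B + 2)) powr (m - m) * mass m x"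
    using B_ge_1 by auto
next
  case (step n)
  have e: "real_of_int (n + 1 - m) = real_of_int (n - m) + 1" by simp
  have "(B + 2) powr (n - m) * mass n x \<le> (B + 2) powr (n - m) * ((B + 2) * mass (n + 1) x)"
    using mass_next[of n x] by (intro mult_left_mono) auto
  then show "mass m x \<le> (B + 2) powr (n + 1 - m) * mass (n + 1) x"
    using step B_ge_1 unfolding e powr_add by (simp add: algebra_simps)
  have "mass (n + 1) x \<le> B / (B + 2) * mass n x"
    using mass_next[of n x] B_ge_1 by (simp add: field_simps)
  also have "\<dots> \<le> B / (B + 2) * ((B / (B + 2)) powr (n - m) * mass m x)"
    using step B_ge_1 by (intro mult_left_mono) auto
  finally show "mass (n + 1) x \<le> (B / (B + 2)) powr (n + 1 - m) * mass m x"
    using B_ge_1 unfolding e powr_add by (simp add: algebra_simps)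
qed

lemma mass_small:
  assumes "0 < e"
  obtains n where "mass n x < e"
proof -
  have "B / (B + 2) < 1" using B_ge_1 by simp
  then obtain n :: nat where "(B / (B + 2)) ^ n < e / mass 0 x"
    using real_arch_pow_inv[of "e / mass 0 x" "B / (B + 2)"] assms mass_pos by auto
  then have "(B / (B + 2)) ^ n * mass 0 x < e"
    using mass_pos[of 0 x] by (simp add: field_simps)
  moreover have "mass (int n) x \<le> (B / (B + 2)) ^ n * mass 0 x"
    using mass_scale(2)[of 0 "int n" x] B_ge_1 by (simp add: powr_realpow)
  ultimately show ?thesis using that[of "int n"] by simp
qed

text \<open>The intervals of values \<open>[left_value n x, left_value n x + mass n x]\<close> decrease with \<open>n\<close>. This
  is what makes \<open>warp\<close> well defined below, without an appeal to limits.\<close>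
lemma left_value_next:
  "left_value n x \<le> left_value (n + 1) x"
  "left_value (n + 1) x + mass (n + 1) x \<le> left_value n x + mass n x"
proof -
  obtain d where d: "d \<in> {0, 1, 2}" "cell (n + 1) x = 3 * cell n x + d"
    by (rule cell_next)
  let ?c = "(B + 2) powr - (n + 1)"
  have pos: "0 \<le> ?c" by simp
  have l: "left_value n x = ?c * cumul (3 * cell n x)"
    unfolding left_value_def powr_shrink[of n] cumul_triple by (simp add: mult.assoc mult.left_commute)
  have "mass n x = ?c * ((B + 2) * (cumul (cell n x + 1) - cumul (cell n x)))"
    unfolding mass_def powr_shrink[of n] cumul_step by simp
  then have r: "left_value n x + mass n x = ?c * cumul (3 * (cell n x + 1))"
    unfolding l cumul_triple by (simp add: algebra_simps)
  have r': "left_value (n + 1) x + mass (n + 1) x = ?c * cumul (cell (n + 1) x + 1)"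
    unfolding left_value_def mass_def cumul_step by (simp add: distrib_left)
  show "left_value n x \<le> left_value (n + 1) x"
    unfolding l unfolding left_value_def d(2) using d(1)
    by (intro mult_left_mono cumul_mono) auto
  show "left_value (n + 1) x + mass (n + 1) x \<le> left_value n x + mass n x"
    unfolding r r' d(2) using d(1) by (intro mult_left_mono cumul_mono) auto
qed

lemma left_value_le_right_value: "left_value n x \<le> left_value m x + mass m x"
proof -
  have l: "left_value i x \<le> left_value j x" if "i \<le> j" for i j
    using int_steps_le[of "\<lambda>n. left_value n x"] left_value_next(1) that by blast
  have r: "- (left_value i x + mass i x) \<le> - (left_value j x + mass j x)" if "i \<le> j" for i j
  proof (rule int_steps_le[of "\<lambda>n. - (left_value n x + mass n x)"])
    show "- (left_value n x + mass n x) \<le> - (left_value (n + 1) x + mass (n + 1) x)" for n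
      using left_value_next(2)[of n x] by simp
  qed (fact that)
  show ?thesis
    using l[of n "max m n"] r[of m "max m n"] mass_pos[of "max m n" x] by simp
qed

section \<open>Its distribution function is quasisymmetric\<close>

definition warp :: "real \<Rightarrow> real" where
  "warp x = (SUP n. left_value n x)"

lemma warp_bounds: "left_value n x \<le> warp x" "warp x \<le> left_value n x + mass n x"
proof -
  show "left_value n x \<le> warp x"
    unfolding warp_def
    by (rule cSUP_upper) (auto intro!: bdd_aboveI2[of _ _ "left_value 0 x + mass 0 x"] left_value_le_right_value)
  show "warp x \<le> left_value n x + mass n x"
    unfolding warp_def by (rule cSUP_least) (auto intro: left_value_le_right_value)
qed

lemma warp_cell_bounds:
  fixes n :: int
  shows "j \<le> cell n x \<Longrightarrow> (B + 2) powr - n * cumul j \<le> warp x"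
    and "cell n x < j \<Longrightarrow> warp x \<le> (B + 2) powr - n * cumul j"
proof -
  show "(B + 2) powr - n * cumul j \<le> warp x" if "j \<le> cell n x"
    using warp_bounds(1)[of n x] mult_left_mono[OF cumul_mono[OF that], of "(B + 2) powr - n"]
    by (simp add: left_value_def)
  assume "cell n x < j"
  then have "cell n x + 1 \<le> j" by simp
  then show "warp x \<le> (B + 2) powr - n * cumul j"
    using warp_bounds(2)[of x n] mult_left_mono[OF cumul_mono, of "cell n x + 1" j "(B + 2) powr - n"]
    unfolding left_value_def mass_def cumul_step by (simp add: distrib_left)
qed

text \<open>A point at distance at most \<open>3 powr - n\<close> lies in the same interval of generation \<open>n\<close> or in a
  neighbouring one, and neighbours have comparable masses.\<close>
lemma warp_upper:
  fixes n :: int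
  assumes "\<bar>x - y\<bar> \<le> 3 powr - n"
  shows "\<bar>warp x - warp y\<bar> \<le> (1 + B) * mass n x"
proof -
  let ?k = "cell n x" and ?c = "(B + 2) powr - n"
  have "\<bar>x * 3 powr n - y * 3 powr n\<bar> = \<bar>x - y\<bar> * 3 powr n"
    by (simp add: abs_mult left_diff_distrib[symmetric])
  also have "\<dots> \<le> 3 powr - n * 3 powr n"
    using assms by (intro mult_right_mono) auto
  also have "\<dots> = 1" by (simp add: powr_add[symmetric])
  finally have "\<bar>x * 3 powr n - y * 3 powr n\<bar> \<le> 1" .
  then have y: "?k - 1 \<le> cell n y" "cell n y < ?k + 2" by linarith+
  have x: "?c * cumul ?k \<le> warp x" "warp x \<le> ?c * cumul (?k + 1)"
    by (rule warp_cell_bounds; simp)+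
  have y': "?c * cumul (?k - 1) \<le> warp y" "warp y \<le> ?c * cumul (?k + 2)"
    using warp_cell_bounds y by blast+
  have "warp x - warp y \<le> ?c * (weight (?k - 1) + weight ?k)"
    using x y' cumul_step[of ?k] cumul_step[of "?k - 1"] by (simp add: algebra_simps)
  also have "\<dots> \<le> ?c * (B * weight ?k + weight ?k)"
    using weight_adjacent[of "?k - 1"] by (intro mult_left_mono) auto
  finally have 1: "warp x - warp y \<le> (1 + B) * mass n x" by (simp add: mass_def algebra_simps)
  have "warp y - warp x \<le> ?c * (weight ?k + weight (?k + 1))"
    using x y' cumul_step[of ?k] cumul_step[of "?k + 1"] by (simp add: algebra_simps)
  also have "\<dots> \<le> ?c * (weight ?k + B * weight ?k)"
    using weight_adjacent[of "?k"] by (intro mult_left_mono) auto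
  finally have 2: "warp y - warp x \<le> (1 + B) * mass n x" by (simp add: mass_def algebra_simps)
  from 1 2 show ?thesis by simp
qed

text \<open>A point at distance at least \<open>2 * 3 powr - n\<close> is separated from \<open>x\<close> by a complete neighbour of
  the interval around \<open>x\<close>.\<close>
lemma warp_lower:
  fixes n :: int
  assumes "2 * 3 powr - n \<le> \<bar>x - z\<bar>"
  shows "mass n x \<le> B * \<bar>warp x - warp z\<bar>"
proof -
  let ?k = "cell n x" and ?c = "(B + 2) powr - n"
  have "2 = 2 * 3 powr - n * 3 powr n" by (simp add: powr_add[symmetric])
  also have "\<dots> \<le> \<bar>x - z\<bar> * 3 powr n"
    using assms by (intro mult_right_mono) auto
  also have "\<dots> = \<bar>x * 3 powr n - z * 3 powr n\<bar>"
    by (simp add: abs_mult left_diff_distrib[symmetric])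
  finally have "cell n z < ?k - 1 \<or> ?k + 2 \<le> cell n z" by linarith
  then show ?thesis
  proof
    assume "?k + 2 \<le> cell n z"
    then have "?c * cumul (?k + 2) \<le> warp z" "warp x \<le> ?c * cumul (?k + 1)"
      by (rule warp_cell_bounds) (rule warp_cell_bounds, simp)
    then have "?c * weight (?k + 1) \<le> \<bar>warp x - warp z\<bar>"
      using cumul_step[of "?k + 1"] by (simp add: algebra_simps)
    then have "B * (?c * weight (?k + 1)) \<le> B * \<bar>warp x - warp z\<bar>"
      using B_ge_1 by (intro mult_left_mono) auto
    moreover have "?c * weight ?k \<le> ?c * (B * weight (?k + 1))"
      using weight_adjacent[of ?k] by (intro mult_left_mono) auto
    ultimately show ?thesis by (simp add: mass_def algebra_simps)
  next
    assume "cell n z < ?k - 1"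
    then have "warp z \<le> ?c * cumul (?k - 1)" "?c * cumul ?k \<le> warp x"
      by (rule warp_cell_bounds) (rule warp_cell_bounds, simp)
    then have "?c * weight (?k - 1) \<le> \<bar>warp x - warp z\<bar>"
      using cumul_step[of "?k - 1"] by (simp add: algebra_simps)
    then have "B * (?c * weight (?k - 1)) \<le> B * \<bar>warp x - warp z\<bar>"
      using B_ge_1 by (intro mult_left_mono) auto
    moreover have "?c * weight ?k \<le> ?c * (B * weight (?k - 1))"
      using weight_adjacent[of "?k - 1"] by (intro mult_left_mono) auto
    ultimately show ?thesis by (simp add: mass_def algebra_simps)
  qed
qed

lemma warp_inj: "warp x = warp z \<longleftrightarrow> x = z"
proof
  assume *: "warp x = warp z"
  show "x = z"
  proof (rule ccontr)
    assume "x \<noteq> z"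
    then obtain n :: int where "\<bar>x - z\<bar> / 6 \<le> 3 powr - n" "3 powr - n < 3 * (\<bar>x - z\<bar> / 6)"
      using triadic_scale[of "\<bar>x - z\<bar> / 6"] by auto
    then have "mass n x \<le> B * \<bar>warp x - warp z\<bar>" by (intro warp_lower) simp
    then show False using mass_pos[of n x] * by simp
  qed
qed simp

text \<open>The control function of \<open>warp\<close>. The exponents are the two extreme rates at which the mass of an
  interval can change with its length; the factor \<open>18\<close> absorbs the rounding of distances to triadic
  scales.\<close>
definition dilation :: "real \<Rightarrow> real" where
  "dilation t = B * (1 + B) * ((18 * t) powr log 3 (B + 2) + (18 * t) powr log 3 ((B + 2) / B))"

lemma homeomorphic_map_dilation:
  "homeomorphic_map (top_of_set {0..}) (top_of_set {0..}) dilation"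
proof -
  have "0 < log 3 (B + 2)" "0 < log 3 ((B + 2) / B)"
    using B_ge_1 by simp_all
  then show ?thesis
    unfolding dilation_def[abs_def] using B_ge_1 by (intro homeomorphic_map_gauge) auto
qed

text \<open>Depending on which of the two scales is the smaller one, the first or the second power is
  needed; their sum covers both cases.\<close>
lemma mass_ratio:
  fixes m n :: int
  assumes T: "3 powr (n - m) \<le> T"
  shows "mass m x \<le> (T powr log 3 (B + 2) + T powr log 3 ((B + 2) / B)) * mass n x"
proof -
  have *: "c powr (n - m) \<le> T powr log 3 c" if "1 < c" for c
  proof -
    have "c powr (n - m) = (3 powr (n - m)) powr log 3 c"
      using that by (metis (no_types) powr_powr powr_powr_swap powr_log_cancel less_trans zero_less_one
          zero_less_numeral numeral_eq_one_iff semiring_norm(84))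
    also have "\<dots> \<le> T powr log 3 c"
      using that T by (intro powr_mono2) auto
    finally show ?thesis .
  qed
  show ?thesis
  proof (cases "m \<le> n")
    case True
    have "mass m x \<le> (B + 2) powr (n - m) * mass n x"
      by (rule mass_scale(1)[OF True])
    also have "\<dots> \<le> (T powr log 3 (B + 2) + T powr log 3 ((B + 2) / B)) * mass n x"
      using *[of "B + 2"] B_ge_1 mass_pos[of n x] by (intro mult_right_mono add_increasing2) auto
    finally show ?thesis .
  next
    case False
    then have "mass m x \<le> (B / (B + 2)) powr (m - n) * mass n x"
      by (intro mass_scale(2)) simp
    also have "(B / (B + 2)) powr (m - n) = ((B + 2) / B) powr (n - m)"
    proof -
      have "((B + 2) / B) powr (n - m) = ((B + 2) / B) powr - real_of_int (m - n)" by simp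
      also have "\<dots> = inverse ((B + 2) / B) powr (m - n)"
        using B_ge_1 by (simp only: powr_minus inverse_powr)
      finally show ?thesis by (simp add: inverse_divide)
    qed
    also have "\<dots> * mass n x \<le> (T powr log 3 (B + 2) + T powr log 3 ((B + 2) / B)) * mass n x"
      using *[of "(B + 2) / B"] B_ge_1 mass_pos[of n x] by (intro mult_right_mono add_increasing) auto
    finally show ?thesis .
  qed
qed

text \<open>Both image distances are compared to masses of intervals around the common point \<open>x\<close>, at the
  scales \<open>m\<close> and \<open>n\<close> of \<open>\<bar>x - y\<bar>\<close> and \<open>\<bar>x - z\<bar>\<close>; the masses are then compared by \<open>mass_ratio\<close>.\<close>
lemma warp_quasisymmetric:
  assumes "0 \<le> t" "\<bar>x - y\<bar> \<le> t * \<bar>x - z\<bar>"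
  shows "\<bar>warp x - warp y\<bar> \<le> dilation t * \<bar>warp x - warp z\<bar>"
proof (cases "x = y")
  case True
  then show ?thesis using B_ge_1 by (simp add: dilation_def)
next
  case False
  then have xz: "0 < \<bar>x - z\<bar>" using assms by auto
  \<comment> \<open>Dividing by \<open>6\<close> gives \<open>2 * 3 powr - n < \<bar>x - z\<bar> \<le> 6 * 3 powr - n\<close>, as \<open>warp_lower\<close> requires.\<close>
  obtain n :: int where n: "\<bar>x - z\<bar> / 6 \<le> 3 powr - n" "3 powr - n < 3 * (\<bar>x - z\<bar> / 6)"
    using triadic_scale[of "\<bar>x - z\<bar> / 6"] xz by auto
  obtain m :: int where m: "\<bar>x - y\<bar> \<le> 3 powr - m" "3 powr - m < 3 * \<bar>x - y\<bar>"
    using triadic_scale[of "\<bar>x - y\<bar>"] False by auto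
  have "3 powr - m \<le> 3 * (t * (6 * 3 powr - n))"
    using m(2) assms(2) mult_left_mono[OF n(1) assms(1)] by simp
  then have "3 powr - m * 3 powr n \<le> 18 * t * (3 powr - n * 3 powr n)"
    by (simp add: mult_right_mono)
  then have "3 powr (n - m) \<le> 18 * t"
    by (simp add: powr_add[symmetric])
  note ratio = mass_ratio[OF this, of x]
  let ?d = "(18 * t) powr log 3 (B + 2) + (18 * t) powr log 3 ((B + 2) / B)"
  have "mass n x \<le> B * \<bar>warp x - warp z\<bar>"
    using n by (intro warp_lower) simp
  then have "mass m x \<le> ?d * (B * \<bar>warp x - warp z\<bar>)"
    using ratio by (meson add_nonneg_nonneg mult_left_mono order_trans powr_ge_zero)
  then have "(1 + B) * mass m x \<le> (1 + B) * (?d * (B * \<bar>warp x - warp z\<bar>))"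
    using B_ge_1 by (intro mult_left_mono) auto
  then show ?thesis
    using warp_upper[OF m(1)] by (simp add: dilation_def algebra_simps)
qed

section \<open>The associated metric\<close>

definition weighted_metric :: "real \<Rightarrow> real metric" where
  "weighted_metric \<omega> = metric (UNIV, \<lambda>x y. \<bar>warp (x + \<omega>) - warp (y + \<omega>)\<bar>)"

lemma Metric_space_weighted: "Metric_space UNIV (\<lambda>x y. \<bar>warp (x + \<omega>) - warp (y + \<omega>)\<bar>)"
  by unfold_locales (auto simp: warp_inj)

lemma weighted_metric_simps [simp]:
  "mspace (weighted_metric \<omega>) = UNIV"
  "mdist (weighted_metric \<omega>) = (\<lambda>x y. \<bar>warp (x + \<omega>) - warp (y + \<omega>)\<bar>)"
  unfolding weighted_metric_def
  by (simp_all add: Metric_space.mspace_metric[OF Metric_space_weighted]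
      Metric_space.mdist_metric[OF Metric_space_weighted])

text \<open>Balls of the two metrics are nested in each other: one direction is \<open>warp_upper\<close> together with
  the fact that masses tend to \<open>0\<close>, the other one is \<open>warp_lower\<close>.\<close>
lemma mtopology_weighted_metric: "mtopology_of (weighted_metric \<omega>) = euclidean"
proof -
  interpret W: Metric_space UNIV "\<lambda>x y. \<bar>warp (x + \<omega>) - warp (y + \<omega>)\<bar>"
    by (rule Metric_space_weighted)
  have ball_in: "\<exists>e>0. ball x e \<subseteq> W.mball x r" if "0 < r" for x r
  proof -
    have "0 < r / (1 + B)" using that B_ge_1 by simp
    then obtain n where "mass n (x + \<omega>) < r / (1 + B)"
      by (rule mass_small)
    then have n: "(1 + B) * mass n (x + \<omega>) < r"
      using B_ge_1 by (simp add: field_simps)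
    have "ball x (3 powr - n) \<subseteq> W.mball x r"
    proof
      fix y assume "y \<in> ball x (3 powr - n)"
      then have "\<bar>(x + \<omega>) - (y + \<omega>)\<bar> \<le> 3 powr - n" by (simp add: dist_real_def)
      from warp_upper[OF this] n show "y \<in> W.mball x r" by simp
    qed
    then show ?thesis by (intro exI[of _ "3 powr - n"]) simp
  qed
  have in_ball: "\<exists>r>0. W.mball x r \<subseteq> ball x e" if e: "0 < e" for x e
  proof -
    obtain n :: int where n: "3 powr - n < 3 * (e / 6)"
      using triadic_scale[of "e / 6"] e by auto
    have "W.mball x (mass n (x + \<omega>) / B) \<subseteq> ball x e"
    proof
      fix y assume "y \<in> W.mball x (mass n (x + \<omega>) / B)"
      then have "B * \<bar>warp (x + \<omega>) - warp (y + \<omega>)\<bar> < mass n (x + \<omega>)"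
        using B_ge_1 by (simp add: field_simps)
      then have "\<not> 2 * 3 powr - n \<le> \<bar>(x + \<omega>) - (y + \<omega>)\<bar>"
        using warp_lower[of n "x + \<omega>" "y + \<omega>"] by linarith
      then show "y \<in> ball x e" using n by (simp add: dist_real_def)
    qed
    then show ?thesis using B_ge_1 mass_pos[of n "x + \<omega>"]
      by (intro exI[of _ "mass n (x + \<omega>) / B"]) simp
  qed
  have "mtopology_of (weighted_metric \<omega>) = W.mtopology"
    unfolding mtopology_of_def by simp
  also have "\<dots> = euclidean"
    unfolding topology_eq W.openin_mtopology open_openin[symmetric] open_contains_ball
    using ball_in in_ball by (meson subset_UNIV subset_trans)
  finally show ?thesis .
qed

lemma quasisymmetric_weighted_metric:
  "quasisymmetric (submetric euclidean_metric S) (submetric (weighted_metric \<omega>) S) id"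
proof -
  have "mtopology_of (submetric (weighted_metric \<omega>) S) = mtopology_of (submetric euclidean_metric S)"
    by (simp add: mtopology_of_submetric mtopology_weighted_metric)
  moreover have "\<bar>warp (x + \<omega>) - warp (y + \<omega>)\<bar> \<le> dilation t * \<bar>warp (x + \<omega>) - warp (z + \<omega>)\<bar>"
    if "0 \<le> t" "dist x y \<le> t * dist x z" for x y z t
    using warp_quasisymmetric[of t "x + \<omega>" "y + \<omega>" "z + \<omega>"] that by (simp add: dist_real_def)
  ultimately show ?thesis
    unfolding quasisymmetric_def
    using homeomorphic_map_dilation by (auto intro!: exI[of _ dilation])
qed

section \<open>Typical points lie in light intervals\<close>

text \<open>Infinitely many generations, instead of all sufficiently large ones, are enough for a covering
  argument. A point outside is heavy in every generation from some \<open>N\<close> on, and for fixed \<open>N\<close> the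
  measure of the set of such points is bounded by what happens in any single generation \<open>n \<ge> N\<close>.\<close>
definition light :: "real \<Rightarrow> real set" where
  "light r = {x. \<forall>N. \<exists>n\<ge>N. mass (int n) x \<le> r ^ n}"

lemma mass_measurable [measurable]: "mass n \<in> borel_measurable borel"
proof -
  have "(\<lambda>x. weight (cell n x)) \<in> borel_measurable borel"
    by (rule measurable_compose[where N = "count_space UNIV"]) measurable
  then show ?thesis unfolding mass_def[abs_def] by simp
qed

lemma light_measurable [measurable]: "light r \<in> sets borel"
proof -
  have "{x. mass (int n) x \<le> r ^ n} \<in> sets borel" for n
    using mass_measurable[of "int n"] unfolding borel_measurable_iff_le by simp
  then have "(\<Inter>N. \<Union>n\<in>{N..}. {x. mass (int n) x \<le> r ^ n}) \<in> sets borel"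
    by (intro sets.countable_INT'' sets.countable_UN'') auto
  moreover have "light r = (\<Inter>N. \<Union>n\<in>{N..}. {x. mass (int n) x \<le> r ^ n})"
    by (auto simp: light_def)
  ultimately show ?thesis by simp
qed

text \<open>Each subdivision multiplies the sum of the \<open>u\<close>-th powers of the masses by the same factor, as the
  three children carry \<open>1\<close>, \<open>B\<close> and \<open>1\<close> times the weight of their parent.\<close>
lemma weight_moment:
  assumes "a \<le> b"
  shows "(\<Sum>k\<in>{a * 3 ^ n..<b * 3 ^ n}. weight k powr u) = (2 + B powr u) ^ n * (\<Sum>k\<in>{a..<b}. weight k powr u)"
proof (induction n)
  case (Suc n)
  have "weight (3 * k) powr u + weight (3 * k + 1) powr u + weight (3 * k + 2) powr u
      = (2 + B powr u) * weight k powr u" for k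
    using weight_child[of 0 k] weight_child[of 1 k] weight_child[of 2 k] B_ge_1 weight_pos[of k]
    by (simp add: powr_mult algebra_simps)
  moreover have "a * 3 ^ n \<le> b * 3 ^ n" using assms by (rule mult_right_mono) simp
  ultimately have "(\<Sum>k\<in>{3 * (a * 3 ^ n)..<3 * (b * 3 ^ n)}. weight k powr u)
      = (\<Sum>k\<in>{a * 3 ^ n..<b * 3 ^ n}. (2 + B powr u) * weight k powr u)"
    by (simp only: sum_triples)
  moreover have "a * 3 ^ Suc n = 3 * (a * 3 ^ n)" "b * 3 ^ Suc n = 3 * (b * 3 ^ n)"
    by simp_all
  ultimately show ?case
    by (simp only: sum_distrib_left[symmetric] Suc power_Suc mult.assoc)
qed simp

text \<open>A Chernoff bound. The \<open>u\<close>-th power of the ratio between the mass of an interval and \<open>r ^ n\<close> is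
  at least \<open>1\<close> on the intervals to be counted, and its sum over all intervals of the window is known from
  \<open>weight_moment\<close>. The factor \<open>\<theta>\<close> is the resulting rate per generation.\<close>
lemma heavy_measure_le:
  assumes u: "0 < u" and r: "0 < r"
  defines "\<theta> \<equiv> (2 + B powr u) / (3 * ((B + 2) * r) powr u)"
  shows "emeasure lborel {x \<in> {- real M..<real M}. r ^ n < mass (int n) x}
    \<le> ennreal (\<theta> ^ n * (\<Sum>k\<in>{- int M..<int M}. weight k powr u))"
proof -
  let ?J = "{- int M * 3 ^ n..<int M * 3 ^ n}"
  define K where "K = {k \<in> ?J. ((B + 2) * r) ^ n < weight k}"
  have fin: "finite K" unfolding K_def by (rule finite_subset[of _ ?J]) auto
  have c: "0 < (B + 2) * r" using B_ge_1 r by simp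
  have scale: "(3 :: real) powr int n = 3 ^ n" "(B + 2) powr - int n = inverse ((B + 2) ^ n)"
    using B_ge_1 by (simp_all add: powr_realpow powr_minus)
  have "{x \<in> {- real M..<real M}. r ^ n < mass (int n) x}
      \<subseteq> (\<Union>k\<in>K. {real_of_int k / 3 ^ n..<(real_of_int k + 1) / 3 ^ n})"
  proof
    fix x assume x: "x \<in> {x \<in> {- real M..<real M}. r ^ n < mass (int n) x}"
    let ?k = "cell (int n) x"
    have k: "?k = \<lfloor>x * 3 ^ n\<rfloor>" by (simp add: scale(1)[simplified])
    have "- real M * 3 ^ n \<le> x * 3 ^ n" "x * 3 ^ n < real M * 3 ^ n"
      using x mult_right_mono[of "- real M" x "3 ^ n"] by auto
    then have "?k \<in> ?J"
      unfolding k by (simp add: le_floor_iff floor_less_iff)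
    moreover have "((B + 2) * r) ^ n < weight ?k"
    proof -
      have "(B + 2) ^ n * r ^ n < weight ?k"
        using x B_ge_1 by (simp add: mass_def scale(2)[simplified] field_simps)
      then show ?thesis by (simp only: power_mult_distrib)
    qed
    ultimately have "?k \<in> K" by (simp add: K_def)
    moreover have "real_of_int ?k / 3 ^ n \<le> x" "x < (real_of_int ?k + 1) / 3 ^ n"
      unfolding k by (simp_all add: field_simps) linarith
    ultimately show "x \<in> (\<Union>k\<in>K. {real_of_int k / 3 ^ n..<(real_of_int k + 1) / 3 ^ n})" by auto
  qed
  then have "emeasure lborel {x \<in> {- real M..<real M}. r ^ n < mass (int n) x}
      \<le> emeasure lborel (\<Union>k\<in>K. {real_of_int k / 3 ^ n..<(real_of_int k + 1) / 3 ^ n})"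
    by (intro emeasure_mono) auto
  also have "\<dots> \<le> (\<Sum>k\<in>K. emeasure lborel {real_of_int k / 3 ^ n..<(real_of_int k + 1) / 3 ^ n})"
    using fin by (intro emeasure_subadditive_finite) auto
  also have "\<dots> = (\<Sum>k\<in>K. ennreal (1 / 3 ^ n))"
    by (intro sum.cong refl) (simp add: divide_right_mono diff_divide_distrib[symmetric])
  also have "\<dots> = ennreal (\<Sum>k\<in>K. 1 / 3 ^ n)"
    by (rule sum_ennreal) simp
  also have "\<dots> \<le> ennreal (\<Sum>k\<in>?J. (weight k / ((B + 2) * r) ^ n) powr u / 3 ^ n)"
  proof (intro ennreal_leI order_trans[OF sum_mono sum_mono2])
    fix k assume "k \<in> K"
    then have "1 \<le> weight k / ((B + 2) * r) ^ n"
      using c by (simp add: K_def)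
    then show "1 / 3 ^ n \<le> (weight k / ((B + 2) * r) ^ n) powr u / 3 ^ n"
      using u by (intro divide_right_mono ge_one_powr_ge_zero) auto
  qed (auto simp: K_def)
  also have "(\<Sum>k\<in>?J. (weight k / ((B + 2) * r) ^ n) powr u / 3 ^ n)
      = (\<Sum>k\<in>?J. weight k powr u) / (3 * ((B + 2) * r) powr u) ^ n"
  proof -
    have "(((B + 2) * r) ^ n) powr u = (((B + 2) * r) powr u) ^ n"
      by (rule power_powr_swap[OF c])
    then show ?thesis
      using c weight_pos by (simp add: powr_divide sum_divide_distrib[symmetric] power_mult_distrib less_imp_le)
  qed
  also have "\<dots> = \<theta> ^ n * (\<Sum>k\<in>{- int M..<int M}. weight k powr u)"
  proof -
    have "(\<Sum>k\<in>?J. weight k powr u) = (2 + B powr u) ^ n * (\<Sum>k\<in>{- int M..<int M}. weight k powr u)"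
      by (rule weight_moment) simp
    then show ?thesis by (simp only: \<theta>_def power_divide times_divide_eq_left)
  qed
  finally show ?thesis .
qed

text \<open>The hypothesis says that the rate in \<open>heavy_measure_le\<close> is below \<open>1\<close>. Within a bounded window,
  the points that are heavy in all generations from some \<open>N\<close> on thus lie in sets of arbitrarily small
  measure.\<close>
lemma complement_light_null:
  assumes u: "0 < u" and r: "0 < r"
    and small: "2 + B powr u < 3 * ((B + 2) * r) powr u"
  shows "- light r \<in> null_sets lborel"
proof -
  define H where "H = (\<lambda>N M. {x \<in> {- real M..<real M}. \<forall>n\<ge>N. r ^ n < mass (int n) x})"
  have "H N M \<in> null_sets lborel" for N M
  proof
    have "{x. r ^ n < mass (int n) x} \<in> sets borel" for n
      using mass_measurable[of "int n"] unfolding borel_measurable_iff_greater by simp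
    then have "{- real M..<real M} \<inter> (\<Inter>n\<in>{N..}. {x. r ^ n < mass (int n) x}) \<in> sets lborel"
      by (intro sets.Int sets.countable_INT'') auto
    moreover have "H N M = {- real M..<real M} \<inter> (\<Inter>n\<in>{N..}. {x. r ^ n < mass (int n) x})"
      by (auto simp: H_def)
    ultimately show "H N M \<in> sets lborel" by simp
    define \<theta> where "\<theta> = (2 + B powr u) / (3 * ((B + 2) * r) powr u)"
    define C where "C = (\<Sum>k\<in>{- int M..<int M}. weight k powr u)"
    have "0 < ((B + 2) * r) powr u" using B_ge_1 r by simp
    then have "0 \<le> \<theta>" "\<theta> < 1" using small by (auto simp: \<theta>_def field_simps intro!: divide_nonneg_pos)
    then have "(\<lambda>n. ennreal (\<theta> ^ n * C)) \<longlonglongrightarrow> ennreal (0 * C)"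
      by (intro tendsto_ennrealI tendsto_mult LIMSEQ_realpow_zero tendsto_const)
    moreover have "emeasure lborel (H N M) \<le> ennreal (\<theta> ^ n * C)" if "N \<le> n" for n
    proof -
      have "emeasure lborel (H N M) \<le> emeasure lborel {x \<in> {- real M..<real M}. r ^ n < mass (int n) x}"
        by (intro emeasure_mono) (use that in \<open>auto simp: H_def\<close>)
      also have "\<dots> \<le> ennreal (\<theta> ^ n * C)"
        unfolding \<theta>_def C_def by (rule heavy_measure_le[OF u r])
      finally show ?thesis .
    qed
    ultimately have "emeasure lborel (H N M) \<le> ennreal (0 * C)"
      by (intro LIMSEQ_le_const) auto
    then show "emeasure lborel (H N M) = 0" by simp
  qed
  then have "(\<Union>N. \<Union>M. H N M) \<in> null_sets lborel"
    by (intro null_sets_UN)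
  moreover have "- light r \<subseteq> (\<Union>N. \<Union>M. H N M)"
  proof
    fix x assume "x \<in> - light r"
    then have "\<not> (\<forall>N. \<exists>n\<ge>N. mass (int n) x \<le> r ^ n)" by (simp add: light_def)
    then obtain N where "\<forall>n\<ge>N. r ^ n < mass (int n) x" by (meson not_le)
    moreover obtain M :: nat where "\<bar>x\<bar> < real M" using reals_Archimedean2 by blast
    ultimately have "x \<in> H N M" by (auto simp: H_def)
    then show "x \<in> (\<Union>N. \<Union>M. H N M)" by blast
  qed
  moreover have "- light r \<in> sets lborel" by simp
  ultimately show ?thesis using null_sets_subset by blast
qed

section \<open>Light points form a small set\<close>

text \<open>Stage \<open>n\<close> of the covering consists of the light intervals of generation \<open>n\<close> in the window
  \<open>[-n, n)\<close>, at most \<open>2 n 3\<^sup>n\<close> in number. The windows grow, so each light point lies in intervals of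
  infinitely many stages, while the factor \<open>2 n\<close> does not affect summability.\<close>
lemma hausdorff_measure_light:
  assumes s: "0 < s" and r: "0 < r" "3 * r powr s < 1"
  shows "hausdorff_measure (submetric (weighted_metric \<omega>) S) s {x \<in> S. x + \<omega> \<in> light r} = 0"
proof -
  let ?m = "submetric (weighted_metric \<omega>) S"
  \<comment> \<open>The index \<open>k\<close> runs from \<open>0\<close> on, whereas the window begins with the interval \<open>- n * 3 ^ n\<close>.\<close>
  define V where "V = (\<lambda>n k. {x \<in> S. cell (int n) (x + \<omega>) = int k - int n * 3 ^ n \<and> mass (int n) (x + \<omega>) \<le> r ^ n})"
  have r1: "r < 1"
  proof (rule ccontr)
    assume "\<not> r < 1"
    then show False using ge_one_powr_ge_zero[of r s] s r(2) by simp
  qed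
  show ?thesis
  proof (rule hausdorff_measure_limsup_eq_0[OF s, where V = V and L = "\<lambda>n. 2 * n * 3 ^ n" and r = "\<lambda>n. r ^ n"])
    fix n k
    have "ennreal (mdist ?m x y) \<le> ennreal (r ^ n)" if "x \<in> V n k" "y \<in> V n k" for x y
    proof -
      have same: "cell (int n) (y + \<omega>) = cell (int n) (x + \<omega>)"
        using that unfolding V_def mem_Collect_eq by (elim conjE) (simp only:)
      then have "left_value (int n) (y + \<omega>) = left_value (int n) (x + \<omega>)"
          "mass (int n) (y + \<omega>) = mass (int n) (x + \<omega>)"
        unfolding left_value_def mass_def by (simp_all only:)
      then have "\<bar>warp (x + \<omega>) - warp (y + \<omega>)\<bar> \<le> mass (int n) (x + \<omega>)"
        using warp_bounds(1)[of "int n" "x + \<omega>"] warp_bounds(1)[of "int n" "y + \<omega>"]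
          warp_bounds(2)[of "x + \<omega>" "int n"] warp_bounds(2)[of "y + \<omega>" "int n"] by linarith
      also have "\<dots> \<le> r ^ n" using that unfolding V_def by blast
      finally show ?thesis by (intro ennreal_leI) simp
    qed
    then show "V n k \<subseteq> mspace ?m \<and> mdiam ?m (V n k) \<le> ennreal (r ^ n)"
      unfolding mdiam_def by (intro conjI SUP_least) (simp_all add: V_def subset_eq)
  next
    show "0 \<le> r ^ n" for n using r by simp
    show "(\<lambda>n. r ^ n) \<longlonglongrightarrow> 0" using r r1 by (intro LIMSEQ_realpow_zero) auto
    define q where "q = 3 * r powr s"
    have q: "0 \<le> q" "q < 1" using r by (simp_all add: q_def)
    have "real (2 * n * 3 ^ n) * (r ^ n) powr s = 2 * (real n * q ^ n)" for n
      unfolding q_def power_powr_swap[OF r(1)] power_mult_distrib by simp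
    moreover have "summable (\<lambda>n. 2 * (real n * q ^ n))"
    proof (rule summable_mult, rule summable_comparison_test'[of "\<lambda>n. real (Suc n) * q ^ n" 0])
      show "summable (\<lambda>n. real (Suc n) * q ^ n)"
        using geometric_deriv_sums[of q] q by (auto intro: sums_summable)
      show "norm (real n * q ^ n) \<le> real (Suc n) * q ^ n" for n
        using q by (simp add: mult_right_mono)
    qed
    ultimately show "summable (\<lambda>n. real (2 * n * 3 ^ n) * (r ^ n) powr s)"
      by (simp only:)
  next
    fix x N assume x: "x \<in> {x \<in> S. x + \<omega> \<in> light r}"
    obtain M :: nat where M: "\<bar>x + \<omega>\<bar> < real M" using reals_Archimedean2 by blast
    have "\<exists>n\<ge>max N M. mass (int n) (x + \<omega>) \<le> r ^ n"
      using x unfolding light_def mem_Collect_eq by (elim conjE allE)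
    then obtain n where n: "n \<ge> max N M" "mass (int n) (x + \<omega>) \<le> r ^ n" by blast
    have "\<bar>x + \<omega>\<bar> < real n" using M n by simp
    then have "- real n * 3 ^ n \<le> (x + \<omega>) * 3 ^ n" "(x + \<omega>) * 3 ^ n < real n * 3 ^ n"
      using mult_right_mono[of "- real n" "x + \<omega>" "3 ^ n"] by auto
    then have "- int n * 3 ^ n \<le> \<lfloor>(x + \<omega>) * 3 ^ n\<rfloor>" "\<lfloor>(x + \<omega>) * 3 ^ n\<rfloor> < int n * 3 ^ n"
      by (simp_all add: le_floor_iff floor_less_iff)
    moreover have "cell (int n) (x + \<omega>) = \<lfloor>(x + \<omega>) * 3 ^ n\<rfloor>"
      by (simp add: powr_realpow)
    ultimately have c: "- int n * 3 ^ n \<le> cell (int n) (x + \<omega>)" "cell (int n) (x + \<omega>) < int n * 3 ^ n"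
      by (simp_all only:)
    define k where "k = nat (cell (int n) (x + \<omega>) + int n * 3 ^ n)"
    have k: "int k = cell (int n) (x + \<omega>) + int n * 3 ^ n"
      unfolding k_def using c(1) by linarith
    have "int k < int (2 * n * 3 ^ n)"
      unfolding k using c(2) by simp
    then have "k < 2 * n * 3 ^ n" by (simp only: of_nat_less_iff)
    moreover have "x \<in> V n k"
      unfolding V_def k using x n by (intro CollectI conjI) simp_all
    ultimately show "\<exists>n\<ge>N. \<exists>k<2 * n * 3 ^ n. x \<in> V n k"
      using n(1) by (intro exI[of _ n]) (auto intro: exI[of _ k])
  qed
qed

end

section \<open>Conformal dimension\<close>

theorem theorem1p1:
  fixes \<nu> :: "real measure"
  assumes borel: "sets \<nu> = sets borel"
    and locally_finite: "\<forall>x. \<exists>U. open U \<and> x \<in> U \<and> emeasure \<nu> U < \<infinity>"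
  shows "conformal_dim euclidean_metric \<nu> = 0"
proof -
  let ?S = "spt euclidean_metric \<nu>"
  have "conformal_dim euclidean_metric \<nu> \<le> ennreal s" if s: "0 < s" for s
  proof -
    \<comment> \<open>These values make \<open>B powr u = 8\<close> and \<open>r powr u = 1 / 2\<close>. Typical points are then light, as
      \<open>(B + 2) powr u \<ge> 8\<close> and \<open>2 + 8 < 3 * 8 * (1 / 2)\<close>, and the light points are small, as \<open>3 * r powr s = 3 / 4\<close>.\<close>
    define u where "u = s / 2"
    define B where "B = 8 powr (1 / u)"
    define r :: real where "r = (1 / 2) powr (1 / u)"
    have u: "0 < u" using s by (simp add: u_def)
    have B: "1 \<le> B" unfolding B_def using u by (intro ge_one_powr_ge_zero) auto
    have r: "0 < r" by (simp add: r_def)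
    have B_u: "B powr u = 8" and r_u: "r powr u = 1 / 2"
      using u by (simp_all add: B_def r_def powr_powr)
    have "r powr s = r powr (u + u)" by (simp add: u_def)
    then have r_s: "r powr s = 1 / 4" by (simp only: powr_add r_u)
    interpret triadic_weights B by unfold_locales (rule B)
    have "B powr u \<le> (B + 2) powr u" using u B by (intro powr_mono2) auto
    then have "2 + B powr u < 3 * ((B + 2) * r) powr u"
      using B r by (simp add: powr_mult B_u r_u)
    then have "- light r \<in> null_sets lborel"
      by (rule complement_light_null[OF u r])
    then obtain \<omega> where \<omega>: "emeasure \<nu> {x. x + \<omega> \<in> - light r} = 0"
      by (rule exists_null_translate[OF borel sigma_finite_of_locally_finite[OF borel locally_finite]])
    define m' where "m' = submetric (weighted_metric \<omega>) ?S"
    define A where "A = {x. x + \<omega> \<in> light r}"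
    have "A \<in> sets borel"
    proof -
      have "(\<lambda>x. x + \<omega>) -` light r \<inter> space borel \<in> sets borel"
        by (rule measurable_sets[OF _ light_measurable]) simp
      then show ?thesis by (simp add: A_def vimage_def)
    qed
    moreover have "emeasure \<nu> (- A) = 0"
      using \<omega> by (simp add: A_def Compl_eq)
    moreover have "mtopology_of m' = top_of_set ?S"
      by (simp add: m'_def mtopology_of_submetric mtopology_weighted_metric)
    moreover have "hausdorff_measure m' s (?S \<inter> A) = 0"
      using hausdorff_measure_light[OF s r, of \<omega> ?S] r_s by (simp add: m'_def A_def Int_def)
    ultimately have "hausdorff_dim_measure m' (push_forward euclidean_metric \<nu> m' id) \<le> ennreal s"
      using hausdorff_dim_measure_id_le[OF borel] s by blast
    moreover have "quasisymmetric (submetric euclidean_metric ?S) m' id"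
      unfolding m'_def by (rule quasisymmetric_weighted_metric)
    ultimately show ?thesis
      unfolding conformal_dim_def by - (rule INF_lower2[of "(m', id)"], auto)
  qed
  then have "conformal_dim euclidean_metric \<nu> \<le> 0"
    by - (rule ennreal_le_epsilon, simp)
  then show ?thesis by simp
qed

end
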